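(* Let $\varphi$ and $\psi$ be bounded analytic functions on the open unit disc $\mathbb{U}$. The following are equivalent: (a) $\psi$ is subordinate to $\varphi$; (b) $T_\varphi$ and $T_\psi$ are intertwined by a composition operator; (c) $T_\varphi$ and $T_\psi$ are intertwined by a (finite) linear combination of weighted composition operators.
   Context: $\mathbb{U}$ is the open unit disc in $\mathbb{C}$ and $H^2$ is the Hardy space of $\mathbb{U}$. For a bounded analytic function $\varphi$ on $\mathbb{U}$, $T_\varphi:H^2\to H^2$ is the analytic Toeplitz operator $T_\varphi h=\varphi h$. A bounded linear operator $X$ on $H^2$ intertwines $T_\varphi$ and $T_\psi$ if $XT_\varphi=T_\psi X$ and $X\neq 0$. "$\psi$ is subordinate to $\varphi$" means that there is a holomorphic map $\omega:\mathbb{U}\to\mathbb{U}$ with $\psi=\varphi\circ\omega$ (it is not required that $\omega(0)=0$). For $\omega:\mathbb{U}\to\mathbb{U}$ holomorphic, the composition operator $C_\omega$ on $H^2$ is $C_\omega f=f\circ\omega$; a weighted composition operator on $H^2$ is an operator $C_{\omega,h}f=h\cdot(f\circ\omega)$, where $\omega:\mathbb{U}\to\mathbb{U}$ is holomorphic and $h\in H^2$ is such that $h\cdot(f\circ\omega)\in H^2$ for every $f\in H^2$. *)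

theory Defs
  imports "HOL-Complex_Analysis.Complex_Analysis"
begin

abbreviation unit_disc :: "complex set" where
  "unit_disc \<equiv> ball 0 1"

definition bounded_analytic :: "(complex \<Rightarrow> complex) \<Rightarrow> bool" where
  "bounded_analytic \<phi> \<longleftrightarrow> \<phi> holomorphic_on unit_disc \<and> bounded (\<phi> ` unit_disc)"

definition disc_self_map :: "(complex \<Rightarrow> complex) \<Rightarrow> bool" where
  "disc_self_map \<omega> \<longleftrightarrow> \<omega> holomorphic_on unit_disc \<and> \<omega> ` unit_disc \<subseteq> unit_disc"

definition subordinate :: "(complex \<Rightarrow> complex) \<Rightarrow> (complex \<Rightarrow> complex) \<Rightarrow> bool" where
  "subordinate \<psi> \<phi> \<longleftrightarrow> (\<exists>\<omega>. disc_self_map \<omega> \<and> (\<forall>z\<in>unit_disc. \<psi> z = \<phi> (\<omega> z)))"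

definition square_mean :: "(complex \<Rightarrow> complex) \<Rightarrow> real \<Rightarrow> real" where
  "square_mean f r =
     (1 / (2 * pi)) * integral {0..2 * pi} (\<lambda>t. (cmod (f (complex_of_real r * cis t)))\<^sup>2)"

text \<open>
  A function on the disc is represented by its extension by \<open>0\<close> to the whole plane. Hence two
  members of \<open>H2\<close> are equal iff they agree on the disc, and the vector space structure is the
  pointwise one.
\<close>

definition H2 :: "(complex \<Rightarrow> complex) set" where
  "H2 = {f. f holomorphic_on unit_disc \<and> (\<forall>z. z \<notin> unit_disc \<longrightarrow> f z = 0) \<and>
            bdd_above (square_mean f ` {0..<1})}"

definition H2_norm :: "(complex \<Rightarrow> complex) \<Rightarrow> real" where
  "H2_norm f = sqrt (SUP r\<in>{0..<1}. square_mean f r)"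

text \<open>
  Operators on \<open>H2\<close> are maps of which only the restriction to \<open>H2\<close> is relevant; linearity is
  over the complex numbers.
\<close>

type_synonym operator = "(complex \<Rightarrow> complex) \<Rightarrow> (complex \<Rightarrow> complex)"

definition H2_bounded_linear :: "operator \<Rightarrow> bool" where
  "H2_bounded_linear X \<longleftrightarrow>
     (\<forall>f\<in>H2. X f \<in> H2) \<and>
     (\<forall>f\<in>H2. \<forall>g\<in>H2. X (\<lambda>z. f z + g z) = (\<lambda>z. X f z + X g z)) \<and>
     (\<forall>c. \<forall>f\<in>H2. X (\<lambda>z. c * f z) = (\<lambda>z. c * X f z)) \<and>
     (\<exists>K. \<forall>f\<in>H2. H2_norm (X f) \<le> K * H2_norm f)"

definition toeplitz :: "(complex \<Rightarrow> complex) \<Rightarrow> operator" where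
  "toeplitz \<phi> h = (\<lambda>z. \<phi> z * h z)"

definition intertwines ::
    "operator \<Rightarrow> (complex \<Rightarrow> complex) \<Rightarrow> (complex \<Rightarrow> complex) \<Rightarrow> bool" where
  "intertwines X \<phi> \<psi> \<longleftrightarrow>
     H2_bounded_linear X \<and>
     (\<forall>f\<in>H2. X (toeplitz \<phi> f) = toeplitz \<psi> (X f)) \<and>
     (\<exists>f\<in>H2. X f \<noteq> (\<lambda>z. 0))"

definition comp_op :: "(complex \<Rightarrow> complex) \<Rightarrow> operator" where
  "comp_op \<omega> f = (\<lambda>z. if z \<in> unit_disc then f (\<omega> z) else 0)"

definition is_composition_operator :: "operator \<Rightarrow> bool" where
  "is_composition_operator X \<longleftrightarrow>
     (\<exists>\<omega>. disc_self_map \<omega> \<and> (\<forall>f\<in>H2. X f = comp_op \<omega> f))"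

definition weighted_comp_op :: "(complex \<Rightarrow> complex) \<Rightarrow> (complex \<Rightarrow> complex) \<Rightarrow> operator" where
  "weighted_comp_op \<omega> h f = (\<lambda>z. h z * comp_op \<omega> f z)"

definition is_weighted_composition_operator :: "operator \<Rightarrow> bool" where
  "is_weighted_composition_operator X \<longleftrightarrow>
     (\<exists>\<omega> h. disc_self_map \<omega> \<and> h \<in> H2 \<and> (\<forall>f\<in>H2. weighted_comp_op \<omega> h f \<in> H2) \<and>
            (\<forall>f\<in>H2. X f = weighted_comp_op \<omega> h f))"

definition is_lincomb_of_weighted_composition_operators :: "operator \<Rightarrow> bool" where
  "is_lincomb_of_weighted_composition_operators X \<longleftrightarrow>
     (\<exists>(n::nat) (c :: nat \<Rightarrow> complex) W.
        (\<forall>j<n. is_weighted_composition_operator (W j)) \<and>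
        (\<forall>f\<in>H2. X f = (\<lambda>z. \<Sum>j<n. c j * W j f z)))"

end

theory Submission
  imports Defs
begin

text \<open>
  If \<open>\<psi> = \<phi> \<circ> \<omega>\<close> on the disc, then \<open>(\<phi> f) \<circ> \<omega> = \<psi> (f \<circ> \<omega>)\<close>, so the composition operator with
  symbol \<open>\<omega>\<close> satisfies the intertwining relation, and it does not vanish because it fixes the
  constants. What needs an argument is that it is bounded on \<open>H2\<close>. This is Littlewood's
  subordination principle: for \<open>R < 1\<close> the function \<open>|f|\<^sup>2\<close> lies below the Poisson integral of its
  values on the circle \<open>|\<zeta>| = R\<close>, and that integral is a harmonic function of the point, so after
  composition with \<open>\<omega>\<close> its mean over a circle is its value at \<open>\<omega> 0\<close>. For \<open>R\<close> close to \<open>1\<close> this is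
  at most \<open>4 / (1 - |\<omega> 0|)\<close> times the mean of \<open>|f|\<^sup>2\<close> over \<open>|\<zeta>| = R\<close>, by the obvious bound for the
  Poisson kernel at \<open>\<omega> 0\<close> (\<open>square_mean_comp_op_le\<close>).

  A composition operator is a weighted composition operator with weight \<open>1\<close>, which closes one more
  implication.

  Finally let \<open>X f = (\<Sum>j<n. c j * h j * (f \<circ> \<omega> j))\<close> intertwine, and suppose that no \<open>\<omega> j\<close> satisfies
  \<open>\<psi> = \<phi> \<circ> \<omega> j\<close>. Choose \<open>f\<close> with \<open>X f\<close> not identically zero. By the isolation of zeros there is a
  point \<open>z\<close> at which \<open>X f\<close> and all the functions \<open>\<phi> \<circ> \<omega> j - \<psi>\<close> are non-zero. Evaluated at \<open>z\<close>, the
  intertwining relation for a polynomial \<open>p\<close> reads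
  \<open>(\<Sum>j<n. c j * h j z * (\<phi> (\<omega> j z) - \<psi> z) * p (\<omega> j z)) = 0\<close>. Only finitely many values of \<open>p\<close>
  enter, so interpolation makes the \<open>j\<close>-th of them equal to \<open>f (\<omega> j z) / (\<phi> (\<omega> j z) - \<psi> z)\<close>, and the
  relation becomes \<open>X f z = 0\<close>, a contradiction (\<open>lincomb_intertwines_imp_subordinate\<close>).
\<close>

section \<open>The Poisson kernel of a disc\<close>

text \<open>
  The radius of the disc is \<open>cmod \<zeta>\<close>, so that one definition serves the circles of all radii.
\<close>

definition poisson_kernel :: "complex \<Rightarrow> complex \<Rightarrow> real" where
  "poisson_kernel \<zeta> w = ((cmod \<zeta>)\<^sup>2 - (cmod w)\<^sup>2) / (cmod (\<zeta> - w))\<^sup>2"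

lemma poisson_kernel_nonneg: "cmod w \<le> cmod \<zeta> \<Longrightarrow> poisson_kernel \<zeta> w \<ge> 0"
  by (simp add: poisson_kernel_def)

lemma poisson_kernel_0 [simp]: "\<zeta> \<noteq> 0 \<Longrightarrow> poisson_kernel \<zeta> 0 = 1"
  by (simp add: poisson_kernel_def)

lemma poisson_kernel_le:
  assumes "cmod w < cmod \<zeta>"
  shows "poisson_kernel \<zeta> w \<le> (cmod \<zeta> + cmod w) / (cmod \<zeta> - cmod w)"
proof -
  let ?R = "cmod \<zeta>" and ?a = "cmod w"
  have "(?R - ?a)\<^sup>2 \<le> (cmod (\<zeta> - w))\<^sup>2"
    using assms norm_triangle_ineq2[of \<zeta> w] by (intro power_mono) auto
  hence "poisson_kernel \<zeta> w \<le> (?R\<^sup>2 - ?a\<^sup>2) / (?R - ?a)\<^sup>2"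
    unfolding poisson_kernel_def using assms
    by (intro divide_left_mono) (auto intro!: mult_pos_pos power_mono)
  also have "\<dots> = (?R + ?a) / (?R - ?a)"
    using assms by (simp add: power2_eq_square square_diff_square_factored)
  finally show ?thesis .
qed

text \<open>
  In this form the kernel is visibly harmonic in \<open>w\<close>, and so remains harmonic after composition
  with a holomorphic function. At \<open>w = \<zeta>\<close> both sides are \<open>0\<close> because division by zero gives \<open>0\<close>.
\<close>

lemma poisson_kernel_eq_Re: "poisson_kernel \<zeta> w = Re ((\<zeta> + w) / (\<zeta> - w))"
proof -
  have "(cmod \<zeta>)\<^sup>2 - (cmod w)\<^sup>2
      = Re (\<zeta> + w) * Re (\<zeta> - w) + Im (\<zeta> + w) * Im (\<zeta> - w)"
    unfolding cmod_power2 by (simp add: algebra_simps power2_eq_square)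
  thus ?thesis
    by (simp only: poisson_kernel_def Re_divide cmod_power2)
qed

text \<open>
  Cauchy's formula at \<open>w\<close> is applied to \<open>F \<zeta> = g \<zeta> * (R\<^sup>2 - |w|\<^sup>2) / (R\<^sup>2 - cnj w * \<zeta>)\<close> rather than
  to \<open>g\<close>. The extra factor is holomorphic on the closed disc and equals \<open>1\<close> at \<open>w\<close>; on the circle
  \<open>R\<^sup>2 = \<zeta> * cnj \<zeta>\<close>, so it combines with the Cauchy kernel to the Poisson kernel.
\<close>

lemma poisson_formula:
  assumes g: "g holomorphic_on cball 0 R" and w: "cmod w < R"
  shows "((\<lambda>t. of_real (poisson_kernel (of_real R * cis t) w) * g (of_real R * cis t))
            has_integral 2 * of_real pi * g w) {0..2*pi}"
proof -
  have R: "R > 0"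
    using w norm_ge_zero[of w] by linarith
  define d where "d = of_real (R\<^sup>2) - cnj w * w"
  \<comment> \<open>For \<open>w \<noteq> 0\<close> the pole \<open>R\<^sup>2 / cnj w\<close> is the reflection of \<open>w\<close> in the circle, hence outside the disc.\<close>
  have nz: "of_real (R\<^sup>2) - cnj w * \<zeta> \<noteq> 0" if "\<zeta> \<in> cball 0 R" for \<zeta>
  proof
    assume "of_real (R\<^sup>2) - cnj w * \<zeta> = 0"
    hence "cmod (cnj w * \<zeta>) = cmod (of_real (R\<^sup>2))" by (metis eq_iff_diff_eq_0)
    hence "cmod w * cmod \<zeta> = R * R" by (simp add: norm_mult power2_eq_square)
    moreover have "cmod w * cmod \<zeta> \<le> cmod w * R"
      using that by (intro mult_left_mono) auto
    moreover have "cmod w * R < R * R" using w R by simp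
    ultimately show False by linarith
  qed
  define F where "F = (\<lambda>\<zeta>. g \<zeta> * (d / (of_real (R\<^sup>2) - cnj w * \<zeta>)))"
  have "F holomorphic_on cball 0 R"
    unfolding F_def using nz by (intro holomorphic_intros g) auto
  moreover have Fw: "F w = g w"
    using nz[of w] w by (simp add: F_def d_def)
  ultimately have "((\<lambda>u. F u / (u - w)) has_contour_integral (2 * of_real pi * \<i> * g w))
         (circlepath 0 R)"
    using Cauchy_integral_circlepath_simple[of F 0 R w] w by simp
  hence "((\<lambda>t. F (0 + R * cis t) / (0 + R * cis t - w) * R * \<i> * cis t) has_integral
           (2 * of_real pi * \<i> * g w)) {0..2*pi}"
    unfolding circlepath_def by (subst (asm) has_contour_integral_part_circlepath_iff) auto
  from has_integral_mult_right[OF this, of "- \<i>"]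
  have "((\<lambda>t. - \<i> * (F (0 + R * cis t) / (0 + R * cis t - w) * R * \<i> * cis t)) has_integral
           (- \<i> * (2 * of_real pi * \<i> * g w))) {0..2*pi}" .
  moreover have "- \<i> * (2 * of_real pi * \<i> * g w) = 2 * of_real pi * g w"
    by (simp add: mult_ac)
  moreover have "- \<i> * (F (0 + R * cis t) / (0 + R * cis t - w) * R * \<i> * cis t) =
      of_real (poisson_kernel (of_real R * cis t) w) * g (of_real R * cis t)" for t
  proof -
    define \<zeta> where "\<zeta> = of_real R * cis t"
    have zR: "cmod \<zeta> = R" using R by (simp add: \<zeta>_def norm_mult)
    have nz1: "\<zeta> - w \<noteq> 0" using w zR by auto
    have z0: "\<zeta> \<noteq> 0" using R zR by auto
    have RR: "of_real (R\<^sup>2) = \<zeta> * cnj \<zeta>" using complex_norm_square[of \<zeta>] by (simp add: zR)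
    have ker: "of_real (R\<^sup>2) - cnj w * \<zeta> = \<zeta> * cnj (\<zeta> - w)"
      unfolding RR by (simp add: algebra_simps)
    have "complex_of_real (poisson_kernel \<zeta> w) = d / ((\<zeta> - w) * cnj (\<zeta> - w))"
      unfolding poisson_kernel_def d_def of_real_divide of_real_diff complex_norm_square zR
      by (simp only: complex_norm_square mult.commute[of "cnj w"])
    hence "of_real (poisson_kernel \<zeta> w) * g \<zeta> = F \<zeta> / (\<zeta> - w) * \<zeta>"
      unfolding F_def ker using z0 by (simp del: complex_cnj_diff add: mult_ac)
    thus ?thesis unfolding \<zeta>_def by (simp add: mult_ac)
  qed
  ultimately show ?thesis by (simp only:)
qed

lemma mean_value_circle:
  assumes g: "g holomorphic_on cball 0 r" and r: "0 \<le> r"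
  shows "((\<lambda>t. g (of_real r * cis t)) has_integral 2 * of_real pi * g 0) {0..2*pi}"
proof (cases "r = 0")
  case True
  thus ?thesis using has_integral_const_real[of "g 0" 0 "2*pi"]
    by (simp add: scaleR_conv_of_real)
next
  case False
  thus ?thesis using poisson_formula[OF g, of 0] r by simp
qed

text \<open>
  The mean value property of the harmonic function \<open>poisson_kernel \<zeta> \<circ> \<omega>\<close>.
\<close>

lemma poisson_kernel_mean:
  assumes om: "\<omega> holomorphic_on cball 0 r" and r: "0 \<le> r"
    and lt: "\<And>z. z \<in> cball 0 r \<Longrightarrow> cmod (\<omega> z) < cmod \<zeta>"
  shows "((\<lambda>s. poisson_kernel \<zeta> (\<omega> (of_real r * cis s)))
            has_integral 2 * pi * poisson_kernel \<zeta> (\<omega> 0)) {0..2*pi}"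
proof -
  let ?G = "\<lambda>z. (\<zeta> + \<omega> z) / (\<zeta> - \<omega> z)"
  have ne: "\<omega> z \<noteq> \<zeta>" if "z \<in> cball 0 r" for z using lt[OF that] by auto
  have "?G holomorphic_on cball 0 r"
    by (intro holomorphic_intros om) (metis ne eq_iff_diff_eq_0)
  from has_integral_Re[OF mean_value_circle[OF this r]]
  have "((\<lambda>s. Re (?G (of_real r * cis s))) has_integral Re (2 * of_real pi * ?G 0)) {0..2*pi}" .
  moreover have "Re (2 * of_real pi * u) = 2 * pi * Re u" for u :: complex
    by simp
  ultimately have "((\<lambda>s. Re (?G (of_real r * cis s))) has_integral 2 * pi * Re (?G 0)) {0..2*pi}"
    by (simp only:)
  thus ?thesis
    by (simp only: poisson_kernel_eq_Re)
qed

section \<open>Boundedness of composition operators\<close>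

lemma continuous_on_circle:
  assumes "f holomorphic_on unit_disc" "0 \<le> r" "r < 1"
  shows "continuous_on A (\<lambda>t. f (of_real r * cis t))"
proof (rule continuous_on_compose2[OF holomorphic_on_imp_continuous_on[OF assms(1)]])
  show "continuous_on A (\<lambda>t. of_real r * cis t)"
    by (intro continuous_on_mult continuous_on_const continuous_on_cis continuous_on_id)
  show "(\<lambda>t. of_real r * cis t) ` A \<subseteq> unit_disc"
    using assms by (simp add: image_subset_iff norm_mult)
qed

text \<open>
  The kernel is non-negative, so taking norms inside the Poisson formula for the holomorphic
  function \<open>f\<^sup>2\<close> gives the subharmonicity of \<open>|f|\<^sup>2\<close>.
\<close>

lemma norm_square_le_poisson:
  assumes f: "f holomorphic_on unit_disc" and R: "R < 1" and w: "cmod w < R"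
  shows "2 * pi * (cmod (f w))\<^sup>2 \<le>
    integral {0..2*pi} (\<lambda>t. poisson_kernel (of_real R * cis t) w * (cmod (f (of_real R * cis t)))\<^sup>2)"
proof -
  let ?z = "\<lambda>t. of_real R * cis t"
  have R0: "R > 0"
    using w norm_ge_zero[of w] by linarith
  have "(\<lambda>z. (f z)\<^sup>2) holomorphic_on cball 0 R"
    using R by (intro holomorphic_intros holomorphic_on_subset[OF f]) auto
  note P = poisson_formula[OF this w]
  have nz: "cmod (?z t - w) \<noteq> 0" for t
  proof
    assume "cmod (?z t - w) = 0"
    hence "cmod (?z t) = cmod w" by simp
    thus False using w R0 by (simp add: norm_mult)
  qed
  have cont: "continuous_on {0..2*pi} (\<lambda>t. poisson_kernel (?z t) w * (cmod (f (?z t)))\<^sup>2)"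
    unfolding poisson_kernel_def using nz R R0
    by (intro continuous_intros continuous_on_circle[OF f] continuous_on_cis continuous_on_id) auto
  have "cmod (integral {0..2*pi} (\<lambda>t. of_real (poisson_kernel (?z t) w) * (f (?z t))\<^sup>2))
     \<le> integral {0..2*pi} (\<lambda>t. poisson_kernel (?z t) w * (cmod (f (?z t)))\<^sup>2)"
  proof (rule integral_norm_bound_integral)
    show "(\<lambda>t. of_real (poisson_kernel (?z t) w) * (f (?z t))\<^sup>2) integrable_on {0..2*pi}"
      using P by blast
    show "(\<lambda>t. poisson_kernel (?z t) w * (cmod (f (?z t)))\<^sup>2) integrable_on {0..2*pi}"
      using cont by (rule integrable_continuous_real)
    fix t
    have "poisson_kernel (?z t) w \<ge> 0"
      using w R0 by (intro poisson_kernel_nonneg) (simp add: norm_mult)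
    thus "cmod (of_real (poisson_kernel (?z t) w) * (f (?z t))\<^sup>2)
            \<le> poisson_kernel (?z t) w * (cmod (f (?z t)))\<^sup>2"
      by (simp add: norm_mult norm_power)
  qed
  thus ?thesis
    unfolding integral_unique[OF P] by (simp add: norm_mult norm_power)
qed

lemma square_mean_nonneg: "square_mean f r \<ge> 0"
proof -
  have "integral {0..2*pi} (\<lambda>t. (cmod (f (of_real r * cis t)))\<^sup>2) \<ge> 0"
    by (cases "(\<lambda>t. (cmod (f (of_real r * cis t)))\<^sup>2) integrable_on {0..2*pi}")
       (auto intro: integral_nonneg simp: not_integrable_integral)
  thus ?thesis by (simp add: square_mean_def)
qed

text \<open>
  Littlewood's subordination principle. With \<open>\<zeta> t\<close> on the circle of radius \<open>R\<close> and
  \<open>W s = \<omega> (r * cis s)\<close>, integrate \<open>|f (W s)|\<^sup>2 \<le> (1 / 2\<pi>) \<integral> poisson_kernel (\<zeta> t) (W s) |f (\<zeta> t)|\<^sup>2 dt\<close>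
  over \<open>s\<close>. After exchanging the integrals, the inner one is a mean of the harmonic function
  \<open>poisson_kernel (\<zeta> t) \<circ> \<omega>\<close>, which is its value at \<open>0\<close>. The radius \<open>R\<close> has to exceed \<open>|\<omega>|\<close> on the
  closed disc of radius \<open>r\<close>; that it varies with \<open>r\<close> does no harm, as the constant does not.
\<close>

lemma square_mean_comp_op_le:
  assumes f: "f holomorphic_on unit_disc" and om: "disc_self_map \<omega>" and r: "0 \<le> r" "r < 1"
  shows "\<exists>R\<in>{0..<1}. square_mean (comp_op \<omega> f) r \<le> 4 / (1 - cmod (\<omega> 0)) * square_mean f R"
proof -
  have hol: "\<omega> holomorphic_on unit_disc" and sub: "\<And>z. z \<in> unit_disc \<Longrightarrow> cmod (\<omega> z) < 1"
    using om by (auto simp: disc_self_map_def image_subset_iff)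
  have cb: "cball 0 r \<subseteq> unit_disc" using r by auto
  have holr: "\<omega> holomorphic_on cball 0 r" by (rule holomorphic_on_subset[OF hol cb])
  have "\<exists>x\<in>cball 0 r. \<forall>y\<in>cball 0 r. cmod (\<omega> y) \<le> cmod (\<omega> x)"
    using r by (intro continuous_attains_sup continuous_on_norm holomorphic_on_imp_continuous_on[OF holr]) auto
  then obtain x where x: "x \<in> cball 0 r" and xmax: "\<And>y. y \<in> cball 0 r \<Longrightarrow> cmod (\<omega> y) \<le> cmod (\<omega> x)"
    by blast
  define m where "m = cmod (\<omega> x)"
  have m: "0 \<le> m" "m < 1" using sub[of x] x cb by (auto simp: m_def)
  define a where "a = cmod (\<omega> 0)"
  have a: "0 \<le> a" "a \<le> m" using xmax[of 0] r by (auto simp: a_def m_def)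
  \<comment> \<open>Half way between \<open>m\<close> and \<open>1\<close>: larger than \<open>|\<omega>|\<close> on the disc of radius \<open>r\<close>, and at least
    \<open>(1 + a) / 2\<close>, which bounds the kernel at \<open>\<omega> 0\<close> by a constant independent of \<open>r\<close>.\<close>
  define R where "R = (1 + m) / 2"
  have R: "0 < R" "R < 1" "m < R" "(1 + a) / 2 \<le> R" using m a by (auto simp: R_def)
  have omR: "cmod (\<omega> z) < R" if "z \<in> cball 0 r" for z
    using xmax[OF that] R by (simp add: m_def)
  define \<zeta> where "\<zeta> = (\<lambda>t. complex_of_real R * cis t)"
  define W where "W = (\<lambda>s. \<omega> (complex_of_real r * cis s))"
  have z: "cmod (\<zeta> t) = R" for t using R by (simp add: \<zeta>_def norm_mult)
  have WR: "cmod (W s) < R" for s using r by (simp add: W_def omR norm_mult)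
  have ne: "\<zeta> t - W s \<noteq> 0" for s t using z[of t] WR[of s] by auto
  have cW: "continuous_on A W" for A unfolding W_def using r by (intro continuous_on_circle hol)
  have cz: "continuous_on A \<zeta>" for A
    unfolding \<zeta>_def by (intro continuous_on_mult continuous_on_const continuous_on_cis continuous_on_id)
  have cfz: "continuous_on A (\<lambda>t. f (\<zeta> t))" for A
    unfolding \<zeta>_def using R by (intro continuous_on_circle f) auto
  have cfW: "continuous_on A (\<lambda>s. f (W s))" for A
    by (rule continuous_on_compose2[OF holomorphic_on_imp_continuous_on[OF f] cW])
       (use less_trans[OF WR R(2)] in \<open>auto simp: image_subset_iff\<close>)
  define k where "k = (\<lambda>s t. poisson_kernel (\<zeta> t) (W s) * (cmod (f (\<zeta> t)))\<^sup>2)"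
  let ?I = "{0..2*pi}"
  have ck: "continuous_on A (\<lambda>(s, t). k s t)" for A
    unfolding k_def poisson_kernel_def split_def using ne
    by (intro continuous_on_mult continuous_on_divide continuous_on_diff continuous_on_power
          continuous_on_norm continuous_on_compose2[OF cW[of UNIV] continuous_on_fst[OF continuous_on_id]]
          continuous_on_compose2[OF cz[of UNIV] continuous_on_snd[OF continuous_on_id]]
          continuous_on_compose2[OF cfz[of UNIV] continuous_on_snd[OF continuous_on_id]]) auto
  have swap: "integral ?I (\<lambda>s. integral ?I (k s)) = integral ?I (\<lambda>t. integral ?I (\<lambda>s. k s t))"
    using integral_swap_continuous[OF ck, of 0 "2*pi" 0 "2*pi"] by simp
  have int1: "(\<lambda>s. integral ?I (k s)) integrable_on ?I"
    using integral_integrable_2dim[OF ck, of 0 "2*pi" 0 "2*pi"] by simp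
  have mean: "integral ?I (\<lambda>s. k s t) = 2 * pi * poisson_kernel (\<zeta> t) (\<omega> 0) * (cmod (f (\<zeta> t)))\<^sup>2" for t
    unfolding k_def W_def
    using poisson_kernel_mean[OF holr r(1), of "\<zeta> t", unfolded z, OF omR]
    by (intro integral_unique has_integral_mult_left) auto
  have kern: "poisson_kernel (\<zeta> t) (\<omega> 0) \<le> 4 / (1 - a)" for t
  proof -
    have "poisson_kernel (\<zeta> t) (\<omega> 0) \<le> (R + a) / (R - a)"
      using poisson_kernel_le[of "\<omega> 0" "\<zeta> t"] omR[of 0] r by (simp add: z a_def)
    also have "\<dots> \<le> 2 / ((1 - a) / 2)"
      using R a m by (intro frac_le) auto
    finally show ?thesis by simp
  qed
  have "2 * pi * integral ?I (\<lambda>s. (cmod (f (W s)))\<^sup>2) = integral ?I (\<lambda>s. 2 * pi * (cmod (f (W s)))\<^sup>2)"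
    by simp
  also have "\<dots> \<le> integral ?I (\<lambda>s. integral ?I (k s))"
  proof (rule integral_le)
    show "(\<lambda>s. 2 * pi * (cmod (f (W s)))\<^sup>2) integrable_on ?I"
      by (intro integrable_continuous_real continuous_on_mult continuous_on_const
            continuous_on_power continuous_on_norm cfW)
    show "2 * pi * (cmod (f (W s)))\<^sup>2 \<le> integral ?I (k s)" for s
      using norm_square_le_poisson[OF f R(2) WR] by (simp add: k_def \<zeta>_def)
  qed (fact int1)
  also have "\<dots> = integral ?I (\<lambda>t. 2 * pi * (poisson_kernel (\<zeta> t) (\<omega> 0) * (cmod (f (\<zeta> t)))\<^sup>2))"
    by (simp only: swap mean mult.assoc)
  also have "\<dots> \<le> integral ?I (\<lambda>t. 2 * pi * (4 / (1 - a) * (cmod (f (\<zeta> t)))\<^sup>2))"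
  proof (rule integral_le)
    show "2 * pi * (poisson_kernel (\<zeta> t) (\<omega> 0) * (cmod (f (\<zeta> t)))\<^sup>2)
           \<le> 2 * pi * (4 / (1 - a) * (cmod (f (\<zeta> t)))\<^sup>2)" for t
      using kern[of t] by (intro mult_left_mono mult_right_mono) auto
    show "(\<lambda>t. 2 * pi * (4 / (1 - a) * (cmod (f (\<zeta> t)))\<^sup>2)) integrable_on ?I"
      by (intro integrable_continuous_real continuous_on_mult continuous_on_const
            continuous_on_power continuous_on_norm cfz)
    have "\<zeta> t - \<omega> 0 \<noteq> 0" for t using z[of t] omR[of 0] r by auto
    thus "(\<lambda>t. 2 * pi * (poisson_kernel (\<zeta> t) (\<omega> 0) * (cmod (f (\<zeta> t)))\<^sup>2)) integrable_on ?I"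
      unfolding poisson_kernel_def
      by (intro integrable_continuous_real continuous_on_mult continuous_on_divide continuous_on_diff
            continuous_on_const continuous_on_power continuous_on_norm cfz cz) auto
  qed
  also have "\<dots> = 2 * pi * (4 / (1 - a) * integral ?I (\<lambda>t. (cmod (f (\<zeta> t)))\<^sup>2))"
    by simp
  finally have "integral ?I (\<lambda>s. (cmod (f (W s)))\<^sup>2)
      \<le> 4 / (1 - a) * integral ?I (\<lambda>t. (cmod (f (\<zeta> t)))\<^sup>2)"
    by (subst (asm) mult_le_cancel_left_pos) auto
  hence "1 / (2 * pi) * integral ?I (\<lambda>s. (cmod (f (W s)))\<^sup>2)
      \<le> 1 / (2 * pi) * (4 / (1 - a) * integral ?I (\<lambda>t. (cmod (f (\<zeta> t)))\<^sup>2))"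
    by (rule mult_left_mono) simp
  moreover have "square_mean (comp_op \<omega> f) r = 1 / (2 * pi) * integral ?I (\<lambda>s. (cmod (f (W s)))\<^sup>2)"
    using r by (simp add: square_mean_def comp_op_def W_def norm_mult)
  moreover have "square_mean f R = 1 / (2 * pi) * integral ?I (\<lambda>t. (cmod (f (\<zeta> t)))\<^sup>2)"
    by (simp add: square_mean_def \<zeta>_def)
  ultimately have "square_mean (comp_op \<omega> f) r \<le> 4 / (1 - a) * square_mean f R"
    by (simp only: mult.left_commute)
  thus ?thesis using R by (intro bexI[of _ R]) (auto simp: a_def)
qed

lemma H2_norm_nonneg: "H2_norm f \<ge> 0" if "f \<in> H2"
  using that square_mean_nonneg[of f 0] unfolding H2_norm_def H2_def
  by (auto intro!: cSUP_upper2[where x = 0])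

lemma square_mean_le_H2_norm:
  assumes "f \<in> H2" "r \<in> {0..<1}"
  shows "square_mean f r \<le> (H2_norm f)\<^sup>2"
proof -
  have "square_mean f r \<le> (SUP r\<in>{0..<1}. square_mean f r)"
    using assms by (intro cSUP_upper) (auto simp: H2_def)
  moreover from this have "0 \<le> (SUP r\<in>{0..<1}. square_mean f r)"
    using square_mean_nonneg[of f r] by linarith
  ultimately show ?thesis by (simp add: H2_norm_def)
qed

lemma H2_bounded_linear_comp_op:
  assumes om: "disc_self_map \<omega>"
  shows "H2_bounded_linear (comp_op \<omega>)"
proof -
  define K where "K = 4 / (1 - cmod (\<omega> 0))"
  have "\<omega> 0 \<in> unit_disc"
    using om by (auto simp: disc_self_map_def image_subset_iff)
  hence K: "K \<ge> 0" by (simp add: K_def)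
  have bound: "square_mean (comp_op \<omega> f) r \<le> K * (H2_norm f)\<^sup>2"
    if f: "f \<in> H2" and r: "r \<in> {0..<1}" for f r
  proof -
    obtain R where "R \<in> {0..<1}" "square_mean (comp_op \<omega> f) r \<le> K * square_mean f R"
      using square_mean_comp_op_le[of f \<omega> r] f r om unfolding K_def by (auto simp: H2_def)
    thus ?thesis
      using mult_left_mono[OF square_mean_le_H2_norm[OF f] K] by (meson order_trans)
  qed
  have mem: "comp_op \<omega> f \<in> H2" if f: "f \<in> H2" for f
  proof -
    have "(\<lambda>z. f (\<omega> z)) holomorphic_on unit_disc"
      using holomorphic_on_compose_gen[of \<omega> unit_disc f unit_disc] om f
      by (simp add: o_def disc_self_map_def H2_def)
    hence "comp_op \<omega> f holomorphic_on unit_disc"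
      by (rule holomorphic_transform) (simp add: comp_op_def)
    moreover have "bdd_above (square_mean (comp_op \<omega> f) ` {0..<1})"
      using bound[OF f] by (rule bdd_aboveI2)
    ultimately show ?thesis
      by (simp add: H2_def) (simp add: comp_op_def)
  qed
  have norm: "H2_norm (comp_op \<omega> f) \<le> sqrt K * H2_norm f" if f: "f \<in> H2" for f
  proof -
    have "(SUP r\<in>{0..<1}. square_mean (comp_op \<omega> f) r) \<le> K * (H2_norm f)\<^sup>2"
      using bound[OF f] by (intro cSUP_least) auto
    hence "H2_norm (comp_op \<omega> f) \<le> sqrt (K * (H2_norm f)\<^sup>2)"
      unfolding H2_norm_def[of "comp_op \<omega> f"] by (rule real_sqrt_le_mono)
    thus ?thesis using H2_norm_nonneg[OF f] by (simp add: real_sqrt_mult)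
  qed
  show ?thesis
    unfolding H2_bounded_linear_def using mem norm by (auto simp: comp_op_def)
qed

section \<open>Bounded analytic functions as members of the Hardy space\<close>

lemma bounded_analytic_imp_H2:
  assumes "bounded_analytic f" "\<And>z. z \<notin> unit_disc \<Longrightarrow> f z = 0"
  shows "f \<in> H2"
proof -
  obtain B where B: "\<And>z. z \<in> unit_disc \<Longrightarrow> cmod (f z) \<le> B"
    using assms unfolding bounded_analytic_def bounded_iff by blast
  have hol: "f holomorphic_on unit_disc" using assms by (simp add: bounded_analytic_def)
  have "square_mean f r \<le> B\<^sup>2" if r: "r \<in> {0..<1}" for r
  proof -
    have "integral {0..2*pi} (\<lambda>t. (cmod (f (of_real r * cis t)))\<^sup>2) \<le> integral {0..2*pi} (\<lambda>t. B\<^sup>2)"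
    proof (rule integral_le)
      show "(\<lambda>t. (cmod (f (of_real r * cis t)))\<^sup>2) integrable_on {0..2*pi}"
        using r by (intro integrable_continuous_real continuous_on_power continuous_on_norm
                      continuous_on_circle hol) auto
      show "(cmod (f (of_real r * cis t)))\<^sup>2 \<le> B\<^sup>2" for t
        using r by (intro power_mono B) (auto simp: norm_mult)
    qed auto
    thus ?thesis by (simp add: square_mean_def field_simps)
  qed
  hence "bdd_above (square_mean f ` {0..<1})" by (rule bdd_aboveI2)
  thus ?thesis using assms hol by (simp add: H2_def)
qed

lemma bounded_analytic_poly: "bounded_analytic (poly p)"
proof -
  have "compact (poly p ` cball 0 1)"
    by (intro compact_continuous_image continuous_intros) auto
  hence "bounded (poly p ` cball 0 1)" by (rule compact_imp_bounded)
  thus ?thesis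
    unfolding bounded_analytic_def
    by (auto intro!: holomorphic_intros elim: bounded_subset)
qed

lemma bounded_analytic_mult:
  assumes "bounded_analytic f" "bounded_analytic g"
  shows "bounded_analytic (\<lambda>z. f z * g z)"
proof -
  obtain A B where "\<And>z. z \<in> unit_disc \<Longrightarrow> cmod (f z) \<le> A" "\<And>z. z \<in> unit_disc \<Longrightarrow> cmod (g z) \<le> B"
    using assms unfolding bounded_analytic_def bounded_iff by blast
  hence "cmod (f z * g z) \<le> A * B" if "z \<in> unit_disc" for z
    using that unfolding norm_mult
    by (intro mult_mono) (auto intro: order_trans[OF norm_ge_zero])
  hence "bounded ((\<lambda>z. f z * g z) ` unit_disc)" unfolding bounded_iff by blast
  thus ?thesis using assms by (auto simp: bounded_analytic_def intro!: holomorphic_intros)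
qed

text \<open>
  The representative in \<open>H2\<close> of a function given by a formula on the whole plane, such as a
  polynomial.
\<close>

definition restrict_disc :: "(complex \<Rightarrow> complex) \<Rightarrow> complex \<Rightarrow> complex" where
  "restrict_disc f z = (if z \<in> unit_disc then f z else 0)"

lemma restrict_disc_H2:
  assumes "bounded_analytic f"
  shows "restrict_disc f \<in> H2"
proof (rule bounded_analytic_imp_H2)
  have "restrict_disc f holomorphic_on unit_disc"
    by (rule holomorphic_transform[of f]) (use assms in \<open>auto simp: restrict_disc_def bounded_analytic_def\<close>)
  moreover have "restrict_disc f ` unit_disc = f ` unit_disc"
    by (rule image_cong) (auto simp: restrict_disc_def)
  ultimately show "bounded_analytic (restrict_disc f)"
    using assms by (simp add: bounded_analytic_def)
qed (simp add: restrict_disc_def)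

section \<open>The equivalence\<close>

text \<open>
  Newton's scheme: to add a node, correct by a multiple of the polynomial vanishing at the others.
\<close>

lemma polynomial_interpolation:
  fixes v :: "'a :: field \<Rightarrow> 'a"
  assumes "finite S"
  shows "\<exists>p. \<forall>x\<in>S. poly p x = v x"
  using assms
proof (induction S)
  case (insert a S)
  then obtain p where p: "\<forall>x\<in>S. poly p x = v x" by blast
  define q where "q = (\<Prod>x\<in>S. [:- x, 1:])"
  have "poly q x = 0" if "x \<in> S" for x
    using that insert.hyps by (auto simp: q_def poly_prod)
  moreover have "poly q a \<noteq> 0"
    using insert.hyps by (auto simp: q_def poly_prod)
  ultimately have "\<forall>x\<in>insert a S. poly (p + smult ((v a - poly p a) / poly q a) q) x = v x"
    using p by auto
  thus ?case by blast
qed auto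

lemma intertwines_comp_op:
  assumes "disc_self_map \<omega>" "\<And>z. z \<in> unit_disc \<Longrightarrow> \<psi> z = \<phi> (\<omega> z)"
  shows "intertwines (comp_op \<omega>) \<phi> \<psi>"
  unfolding intertwines_def
proof (intro conjI ballI)
  show "H2_bounded_linear (comp_op \<omega>)" by (rule H2_bounded_linear_comp_op) fact
  show "comp_op \<omega> (toeplitz \<phi> f) = toeplitz \<psi> (comp_op \<omega> f)" for f
    using assms by (auto simp: comp_op_def toeplitz_def)
  have "comp_op \<omega> (restrict_disc (poly 1)) 0 = 1"
    using assms by (auto simp: comp_op_def restrict_disc_def disc_self_map_def image_subset_iff)
  thus "\<exists>f\<in>H2. comp_op \<omega> f \<noteq> (\<lambda>z. 0)"
    using restrict_disc_H2[OF bounded_analytic_poly[of 1]] by (metis zero_neq_one)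
qed

lemma composition_imp_lincomb:
  assumes "is_composition_operator X"
  shows "is_lincomb_of_weighted_composition_operators X"
proof -
  from assms obtain \<omega> where om: "disc_self_map \<omega>" and X: "\<forall>f\<in>H2. X f = comp_op \<omega> f"
    by (auto simp: is_composition_operator_def)
  have eq: "weighted_comp_op \<omega> (restrict_disc (poly 1)) f = comp_op \<omega> f" for f
    by (auto simp: weighted_comp_op_def comp_op_def restrict_disc_def)
  have "is_weighted_composition_operator X"
    unfolding is_weighted_composition_operator_def
    using om X H2_bounded_linear_comp_op[OF om] restrict_disc_H2[OF bounded_analytic_poly[of 1]] eq
    by (intro exI[of _ \<omega>] exI[of _ "restrict_disc (poly 1)"]) (auto simp: H2_bounded_linear_def)
  thus ?thesis
    unfolding is_lincomb_of_weighted_composition_operators_def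
    by (intro exI[of _ "1::nat"] exI[of _ "\<lambda>_. 1"] exI[of _ "\<lambda>_. X"]) auto
qed

text \<open>
  At a single generic point \<open>z\<close> the relation involves an operand only through its values at the
  points \<open>\<omega> j z\<close>, which a polynomial can be made to take. The prescription stays consistent if some
  of these points, or even some of the maps \<open>\<omega> j\<close>, coincide, because the prescribed value is a
  function of the point alone.
\<close>

lemma lincomb_intertwines_imp_subordinate:
  assumes phi: "bounded_analytic \<phi>" and psi: "bounded_analytic \<psi>"
    and lin: "is_lincomb_of_weighted_composition_operators X" and int: "intertwines X \<phi> \<psi>"
  shows "subordinate \<psi> \<phi>"
proof (rule ccontr)
  assume not_sub: "\<not> subordinate \<psi> \<phi>"
  from lin obtain n :: nat and c W where W: "\<forall>j<n. is_weighted_composition_operator (W j)"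
    and XW: "\<forall>f\<in>H2. X f = (\<lambda>z. \<Sum>j<n. c j * W j f z)"
    by (auto simp: is_lincomb_of_weighted_composition_operators_def)
  from W obtain \<omega> h where om: "\<And>j. j < n \<Longrightarrow> disc_self_map (\<omega> j)"
    and Wj: "\<And>j f. j < n \<Longrightarrow> f \<in> H2 \<Longrightarrow> W j f = weighted_comp_op (\<omega> j) (h j) f"
    unfolding is_weighted_composition_operator_def by metis
  have X: "X f z = (\<Sum>j<n. c j * h j z * f (\<omega> j z))" if "f \<in> H2" "z \<in> unit_disc" for f z
    using that by (simp add: XW Wj weighted_comp_op_def comp_op_def mult.assoc)
  from int obtain f where f: "f \<in> H2" and Xf: "X f \<noteq> (\<lambda>z. 0)"
    by (auto simp: intertwines_def)
  have XfH: "X f \<in> H2" using int f by (auto simp: intertwines_def H2_bounded_linear_def)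
  then obtain \<beta> where beta: "\<beta> \<in> unit_disc" "X f \<beta> \<noteq> 0"
    using Xf unfolding H2_def by blast
  \<comment> \<open>Zeros are isolated, so all the exceptional sets avoid a punctured neighbourhood of \<open>0\<close>.\<close>
  have ev1: "eventually (\<lambda>z. X f z \<noteq> 0 \<and> z \<in> unit_disc) (at 0)"
    using XfH beta by (intro non_zero_neighbour_alt[of "X f" unit_disc 0 \<beta>]) (auto simp: H2_def)
  have "eventually (\<lambda>z. \<phi> (\<omega> j z) - \<psi> z \<noteq> 0 \<and> z \<in> unit_disc) (at 0)" if j: "j \<in> {..<n}" for j
  proof -
    obtain b where b: "b \<in> unit_disc" "\<psi> b \<noteq> \<phi> (\<omega> j b)"
      using not_sub om[of j] j by (auto simp: subordinate_def)
    have "(\<lambda>z. \<phi> (\<omega> j z)) holomorphic_on unit_disc"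
      using holomorphic_on_compose_gen[of "\<omega> j" unit_disc \<phi> unit_disc] om[of j] j phi
      by (simp add: o_def disc_self_map_def bounded_analytic_def)
    hence "(\<lambda>z. \<phi> (\<omega> j z) - \<psi> z) holomorphic_on unit_disc"
      using psi by (intro holomorphic_on_diff) (auto simp: bounded_analytic_def)
    from non_zero_neighbour_alt[OF this _ _ _ b(1), of 0] b show ?thesis by simp
  qed
  hence ev2: "eventually (\<lambda>z. \<forall>j\<in>{..<n}. \<phi> (\<omega> j z) - \<psi> z \<noteq> 0 \<and> z \<in> unit_disc) (at 0)"
    by (intro eventually_ball_finite) auto
  obtain z where z: "z \<in> unit_disc" "X f z \<noteq> 0" and ne: "\<And>j. j < n \<Longrightarrow> \<phi> (\<omega> j z) \<noteq> \<psi> z"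
    using eventually_happens[OF eventually_conj[OF ev1 ev2]] by auto
  \<comment> \<open>Applying \<open>X (\<phi> P) - \<psi> (X P)\<close> at \<open>z\<close> multiplies the value at \<open>\<omega> j z\<close> by
    \<open>\<phi> (\<omega> j z) - \<psi> z\<close>; the division undoes this and leaves \<open>X f z\<close>.\<close>
  obtain p where p: "\<forall>w\<in>(\<lambda>j. \<omega> j z) ` {..<n}. poly p w = f w / (\<phi> w - \<psi> z)"
    using polynomial_interpolation[of "(\<lambda>j. \<omega> j z) ` {..<n}" "\<lambda>w. f w / (\<phi> w - \<psi> z)"] by auto
  define P where "P = restrict_disc (poly p)"
  have PH: "P \<in> H2" unfolding P_def by (intro restrict_disc_H2 bounded_analytic_poly)
  have "toeplitz \<phi> P = restrict_disc (\<lambda>z. \<phi> z * poly p z)"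
    by (auto simp: toeplitz_def P_def restrict_disc_def)
  hence TH: "toeplitz \<phi> P \<in> H2"
    using restrict_disc_H2[OF bounded_analytic_mult[OF phi bounded_analytic_poly]] by simp
  have Pval: "(\<phi> (\<omega> j z) - \<psi> z) * P (\<omega> j z) = f (\<omega> j z)" if "j < n" for j
    using that p ne[OF that] om[OF that] z
    by (auto simp: P_def restrict_disc_def disc_self_map_def image_subset_iff)
  have "X (toeplitz \<phi> P) z = \<psi> z * X P z"
    using int PH by (simp add: intertwines_def toeplitz_def)
  hence "0 = (\<Sum>j<n. c j * h j z * (\<phi> (\<omega> j z) * P (\<omega> j z))) - \<psi> z * (\<Sum>j<n. c j * h j z * P (\<omega> j z))"
    by (simp add: X[OF TH z(1)] X[OF PH z(1)]) (simp add: toeplitz_def)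
  also have "\<dots> = (\<Sum>j<n. c j * h j z * ((\<phi> (\<omega> j z) - \<psi> z) * P (\<omega> j z)))"
    by (simp add: sum_distrib_left algebra_simps flip: sum_subtractf)
  also have "\<dots> = (\<Sum>j<n. c j * h j z * f (\<omega> j z))"
    by (simp add: Pval)
  also have "\<dots> = X f z" using f z by (simp add: X)
  finally show False using z by simp
qed

theorem theorem4p4:
  fixes \<phi> \<psi> :: "complex \<Rightarrow> complex"
  assumes "bounded_analytic \<phi>" and "bounded_analytic \<psi>"
  shows "(subordinate \<psi> \<phi> \<longleftrightarrow>
            (\<exists>X. is_composition_operator X \<and> intertwines X \<phi> \<psi>)) \<and>
         ((\<exists>X. is_composition_operator X \<and> intertwines X \<phi> \<psi>) \<longleftrightarrow>
            (\<exists>X. is_lincomb_of_weighted_composition_operators X \<and> intertwines X \<phi> \<psi>))"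
proof -
  have "\<exists>X. is_composition_operator X \<and> intertwines X \<phi> \<psi>" if "subordinate \<psi> \<phi>"
    using that intertwines_comp_op unfolding subordinate_def is_composition_operator_def by metis
  thus ?thesis
    using composition_imp_lincomb lincomb_intertwines_imp_subordinate[OF assms] by blast
qed

end
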